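(* (Sylvester's identity for $q$-Manin matrices.) Let $M$ be an $m\times m$ $q$-Manin matrix over $\mathfrak R$ with right and left inverse, and let $1\le n<m$. Put $M_0=(M_{ab})_{1\le a,b\le n}$ and, for $n<i,j\le m$, $M_{i*}=(M_{i1},M_{i2},\ldots,M_{in})$ (a row) and $M_{*j}=(M_{1j},M_{2j},\ldots,M_{nj})^{\top}$ (a column). Define the $(m-n)\times(m-n)$ matrix $B=(B_{ij})_{n+1\le i,j\le m}$ by $$B_{ij}=\big(\det\nolimits_q(M_0)\big)^{-1}\cdot\det\nolimits_q\begin{pmatrix} M_0 & M_{*j} \\ M_{i*} & M_{ij} \end{pmatrix}.$$ Assume that all the matrices involved ($M$, $M_0$, the bordered matrices in the formula for $B_{ij}$, and $B$), as well as their $q$-determinants, are two-sided invertible. Then $B$ is a $q$-Manin matrix and $$\det\nolimits_q B=\big(\det\nolimits_q M_0\big)^{-1}\cdot\det\nolimits_q M.$$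
   Context: Let $q$ be a nonzero complex number and $\mathfrak R$ an associative unital, not necessarily commutative, algebra over $\mathbb C$. A matrix $M=(M_{ij})$ over $\mathfrak R$ is called $q$-Manin if $M_{ij}M_{kj}=q^{-1}M_{kj}M_{ij}$ for all $j$ and all $i<k$, and $M_{ij}M_{kl}-M_{kl}M_{ij}=q^{-1}M_{kj}M_{il}-q\,M_{il}M_{kj}$ for all $i<k$, $j<l$. The $q$-determinant of an $r\times r$ matrix $N$ is $\det_q N=\sum_{\tau\in\mathfrak S_r}(-q)^{-\mathrm{inv}(\tau)}N_{\tau(1)1}N_{\tau(2)2}\cdots N_{\tau(r)r}$, where $\mathrm{inv}(\tau)$ is the number of inversions of $\tau$ (for $B$, rows and columns are taken in the order $n+1,\ldots,m$). *)

theory Defs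
  imports
    Complex_Main
    "HOL-Combinatorics.Permutations"
    "Jordan_Normal_Form.Matrix"
begin

text \<open>
  Matrix indices start at 0: the index \<open>a\<close> of the usual notation corresponds to \<open>a - 1\<close>. In
  particular the rows and columns \<open>n+1, \<dots>, m\<close> are here \<open>n, \<dots>, m - 1\<close>.
\<close>

locale complex_algebra = vector_space scale
  for scale :: "complex \<Rightarrow> 'a::ring_1 \<Rightarrow> 'a" +
  assumes mult_scale_left: "scale c x * y = scale c (x * y)"
    and mult_scale_right: "x * scale c y = scale c (x * y)"

definition q_manin :: "(complex \<Rightarrow> 'a::ring_1 \<Rightarrow> 'a) \<Rightarrow> complex \<Rightarrow> 'a mat \<Rightarrow> bool" where
  "q_manin scale q M \<longleftrightarrow>
    (\<forall>i k j. i < k \<and> k < dim_row M \<and> j < dim_col M \<longrightarrow>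
      M $$ (i, j) * M $$ (k, j) = scale (inverse q) (M $$ (k, j) * M $$ (i, j))) \<and>
    (\<forall>i k j l. i < k \<and> k < dim_row M \<and> j < l \<and> l < dim_col M \<longrightarrow>
      M $$ (i, j) * M $$ (k, l) - M $$ (k, l) * M $$ (i, j) =
      scale (inverse q) (M $$ (k, j) * M $$ (i, l)) - scale q (M $$ (i, l) * M $$ (k, j)))"

definition inv_count :: "nat \<Rightarrow> (nat \<Rightarrow> nat) \<Rightarrow> nat" where
  "inv_count r \<tau> = card {(i, j). i < j \<and> j < r \<and> \<tau> j < \<tau> i}"

text \<open>The factors do not commute; they are multiplied in increasing order of the column.\<close>

definition q_det :: "(complex \<Rightarrow> 'a::ring_1 \<Rightarrow> 'a) \<Rightarrow> complex \<Rightarrow> 'a mat \<Rightarrow> 'a" where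
  "q_det scale q N =
    (\<Sum>\<tau> | \<tau> permutes {0..<dim_row N}.
      scale ((- q) powi (- int (inv_count (dim_row N) \<tau>)))
        (prod_list (map (\<lambda>j. N $$ (\<tau> j, j)) [0..<dim_row N])))"

definition two_sided_invertible :: "'a::ring_1 \<Rightarrow> bool" where
  "two_sided_invertible x \<longleftrightarrow> (\<exists>y. x * y = 1 \<and> y * x = 1)"

text \<open>The following is meaningful only for two-sided invertible elements.\<close>

definition ring_inv :: "'a::ring_1 \<Rightarrow> 'a" where
  "ring_inv x = (THE y. x * y = 1 \<and> y * x = 1)"

definition leading_block :: "nat \<Rightarrow> 'a mat \<Rightarrow> 'a mat" where
  "leading_block n M = mat n n (\<lambda>(a, b). M $$ (a, b))"

definition bordered_mat :: "nat \<Rightarrow> 'a mat \<Rightarrow> nat \<Rightarrow> nat \<Rightarrow> 'a mat" where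
  "bordered_mat n M i j =
    four_block_mat
      (leading_block n M)                  (mat n 1 (\<lambda>(a, _). M $$ (a, j)))
      (mat 1 n (\<lambda>(_, b). M $$ (i, b)))     (mat 1 1 (\<lambda>_. M $$ (i, j)))"

text \<open>The entry of the matrix \<open>B\<close> at position \<open>(i, j)\<close>, for \<open>i\<close> and \<open>j\<close> in \<open>n, \<dots>, m - 1\<close>, is
  stored at position \<open>(i - n, j - n)\<close>.\<close>

definition sylvester_mat ::
    "(complex \<Rightarrow> 'a::ring_1 \<Rightarrow> 'a) \<Rightarrow> complex \<Rightarrow> nat \<Rightarrow> 'a mat \<Rightarrow> 'a mat" where
  "sylvester_mat scale q n M =
    mat (dim_row M - n) (dim_col M - n)
      (\<lambda>(i, j). ring_inv (q_det scale q (leading_block n M)) *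
                q_det scale q (bordered_mat n M (n + i) (n + j)))"

end

theory Submission
  imports Defs
begin

text \<open>
  Consider the quantum Grassmann algebra over the coefficient ring, generated by
  \<open>\<psi>\<^sub>0, \<dots>, \<psi>\<^sub>m\<^sub>-\<^sub>1\<close>, which commute with the coefficients and satisfy
  \<open>\<psi>\<^sub>i\<^sup>2 = 0\<close> and \<open>\<psi>\<^sub>k \<psi>\<^sub>i = - q\<inverse> \<psi>\<^sub>i \<psi>\<^sub>k\<close> for \<open>i < k\<close>. A matrix \<open>M\<close> is
  \<open>q\<close>-Manin exactly when the elements \<open>\<phi>\<^sub>j = \<Sum>i. \<psi>\<^sub>i M\<^sub>i\<^sub>j\<close> given by its columns satisfy
  these relations again, and \<open>q\<close>-minors of \<open>M\<close> are the coefficients of products of the \<open>\<phi>\<^sub>j\<close>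
  (\<open>q_det_eq_foldl_wedge\<close>).

  Put \<open>\<Omega> = \<phi>\<^sub>0 \<cdots> \<phi>\<^sub>n\<^sub>-\<^sub>1\<close>. If \<open>X\<close> solves \<open>M\<^sub>0 X = (M\<^sub>*\<^sub>j)\<^sub>j\<close>, then for \<open>j \<ge> n\<close>
  \<open>\<phi>\<^sub>j = \<Sum>a<n. \<phi>\<^sub>a X\<^sub>a\<^sub>j + \<sigma>\<^sub>j\<close>, where \<open>\<sigma>\<^sub>j = \<Sum>i\<ge>n. \<psi>\<^sub>i S\<^sub>i\<^sub>j\<close> and \<open>S\<close> is the Schur
  complement of \<open>M\<^sub>0\<close>. Every product \<open>g = \<Omega> \<phi>\<^sub>j \<cdots> \<phi>\<^sub>l\<close> satisfies \<open>g \<phi>\<^sub>a = 0\<close> for \<open>a < n\<close>: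
  the relations allow \<open>\<phi>\<^sub>a\<close> to be moved to the left, into \<open>\<Omega>\<close>. Consequently each further factor
  \<open>\<phi>\<^sub>j\<close> can be replaced by \<open>\<sigma>\<^sub>j\<close>, and
  \<open>\<Omega> \<phi>\<^sub>j \<cdots> \<phi>\<^sub>l = \<Omega> \<sigma>\<^sub>j \<cdots> \<sigma>\<^sub>l\<close> (\<open>wedge_reduced_columns\<close>). At an index set
  \<open>{0..<n} \<union> I\<close> with \<open>I\<close> above \<open>n\<close>, the right-hand side splits off the factor \<open>det\<^sub>q M\<^sub>0\<close>
  (\<open>foldl_wedge_factor\<close>), because the \<open>\<sigma>\<^sub>j\<close> do not involve the first \<open>n\<close> generators.

  Three instances of this factorization prove the theorem. One factor \<open>\<phi>\<^sub>j\<close>: the bordered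
  determinants are \<open>det\<^sub>q M\<^sub>0 \<cdot> S\<^sub>i\<^sub>j\<close>, so \<open>B = S\<close>. Two factors: the relations between
  \<open>\<phi>\<^sub>j\<close> and \<open>\<phi>\<^sub>l\<close> become, after cancelling \<open>det\<^sub>q M\<^sub>0\<close>, the \<open>q\<close>-Manin relations of
  \<open>B\<close>. All factors: \<open>det\<^sub>q M = det\<^sub>q M\<^sub>0 \<cdot> det\<^sub>q B\<close>.
\<close>

section \<open>Inversions and ring inverses\<close>

lemma inv_count_Suc:
  "inv_count (Suc r) \<tau> = inv_count r \<tau> + card {i. i < r \<and> \<tau> r < \<tau> i}"
proof -
  let ?A = "{(i, j). i < j \<and> j < r \<and> \<tau> j < \<tau> i}"
  let ?B = "(\<lambda>i. (i, r)) ` {i. i < r \<and> \<tau> r < \<tau> i}"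
  have "{(i, j). i < j \<and> j < Suc r \<and> \<tau> j < \<tau> i} = ?A \<union> ?B"
    by (auto simp: less_Suc_eq)
  moreover have "finite ?A"
    by (rule finite_subset[of _ "{..<r} \<times> {..<r}"]) auto
  moreover have "?A \<inter> ?B = {}"
    by auto
  moreover have "card ?B = card {i. i < r \<and> \<tau> r < \<tau> i}"
    by (rule card_image) (auto simp: inj_on_def)
  ultimately show ?thesis
    by (simp add: inv_count_def card_Un_disjoint)
qed

lemma inv_count_cong:
  "(\<And>i. i < r \<Longrightarrow> \<tau> i = \<sigma> i) \<Longrightarrow> inv_count r \<tau> = inv_count r \<sigma>"
  unfolding inv_count_def by (rule arg_cong[where f = card]) auto

lemma inv_count_snoc:
  assumes "distinct ys"
  shows "inv_count (Suc (length ys)) ((!) (ys @ [x])) =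
    inv_count (length ys) ((!) ys) + card {k \<in> set ys. x < k}"
proof -
  have "{k \<in> set ys. x < k} = (!) ys ` {i. i < length ys \<and> x < ys ! i}"
    by (auto simp: in_set_conv_nth)
  moreover have "inj_on ((!) ys) {i. i < length ys \<and> x < ys ! i}"
    using assms by (auto simp: inj_on_def nth_eq_iff_index_eq)
  ultimately have "card {k \<in> set ys. x < k} = card {i. i < length ys \<and> x < ys ! i}"
    by (simp add: card_image)
  moreover have "{i. i < length ys \<and> x < (ys @ [x]) ! i} = {i. i < length ys \<and> x < ys ! i}"
    by (auto simp: nth_append)
  moreover have "inv_count (length ys) ((!) (ys @ [x])) = inv_count (length ys) ((!) ys)"
    by (rule inv_count_cong) (simp add: nth_append)
  ultimately show ?thesis
    by (simp add: inv_count_Suc)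
qed

lemma ring_inv_left:
  assumes "two_sided_invertible x"
  shows "ring_inv x * x = 1"
proof -
  obtain y where y: "x * y = 1" "y * x = 1"
    using assms by (auto simp: two_sided_invertible_def)
  have unique: "z = y" if "x * z = 1" for z
  proof -
    have "y * x * z = y * (x * z)"
      by (rule mult.assoc)
    then show ?thesis
      using that y by simp
  qed
  have "ring_inv x = y"
    unfolding ring_inv_def
  proof (rule the_equality)
    show "x * y = 1 \<and> y * x = 1"
      using y by blast
  qed (use unique in blast)
  with y show ?thesis
    by simp
qed

section \<open>The quantum Grassmann algebra\<close>

locale q_exterior = complex_algebra scale
  for scale :: "complex \<Rightarrow> 'a::ring_1 \<Rightarrow> 'a" +
  fixes q :: complex
  assumes q_nonzero: "q \<noteq> 0"
begin

text \<open>
  The scalar in \<open>\<psi>\<^sub>J \<psi>\<^sub>i = c \<psi>\<^sub>I\<close>, where \<open>J = I - {i}\<close> and \<open>\<psi>\<^sub>I\<close> is the product of the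
  generators indexed by \<open>I\<close> in increasing order: \<open>\<psi>\<^sub>i\<close> has to pass every larger generator.
\<close>

definition passing_factor :: "nat \<Rightarrow> nat set \<Rightarrow> complex" where
  "passing_factor i I = (- inverse q) ^ card {k \<in> I. i < k}"

text \<open>
  An element of the algebra is encoded by its coefficients on the monomials \<open>\<psi>\<^sub>I\<close>, and \<open>wedge\<close>
  multiplies it from the right by the vector \<open>\<Sum>i. \<psi>\<^sub>i c\<^sub>i\<close>. A product of vectors is thus a
  left fold, started at the unit \<open>vacuum\<close>.
\<close>

definition wedge :: "(nat set \<Rightarrow> 'a) \<Rightarrow> (nat \<Rightarrow> 'a) \<Rightarrow> nat set \<Rightarrow> 'a" where
  "wedge f c I = (\<Sum>i\<in>I. scale (passing_factor i I) (f (I - {i}) * c i))"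

definition vacuum :: "nat set \<Rightarrow> 'a" where
  "vacuum I = (if I = {} then 1 else 0)"

text \<open>
  Extending columns by zero keeps the Manin relations valid for all row indices, so that identities
  between products of columns hold at every index set.
\<close>

definition column :: "'a mat \<Rightarrow> nat \<Rightarrow> nat \<Rightarrow> 'a" where
  "column N j i = (if i < dim_row N then N $$ (i, j) else 0)"

lemma passing_factor_remove_above:
  assumes "finite I" "k \<in> I" "i < k"
  shows "passing_factor i (I - {k}) = - q * passing_factor i I"
proof -
  have "{l \<in> I. i < l} = insert k {l \<in> I - {k}. i < l}"
    using assms by auto
  then have "card {l \<in> I. i < l} = Suc (card {l \<in> I - {k}. i < l})"
    using assms by simp
  then show ?thesis
    using q_nonzero by (simp add: passing_factor_def)
qed

lemma passing_factor_remove_below: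
  assumes "k < i"
  shows "passing_factor i (I - {k}) = passing_factor i I"
proof -
  have "{l \<in> I - {k}. i < l} = {l \<in> I. i < l}"
    using assms by auto
  then show ?thesis
    by (simp add: passing_factor_def)
qed

text \<open>
  Each two-element subset \<open>{i, k}\<close> of \<open>I\<close> arises from two orders of the generators; passing one
  through the other contributes the factor \<open>- q\<close> for one of them. Grouping the two terms shows that
  a product by two vectors only depends on their \<open>q\<close>-minors.
\<close>

lemma wedge_wedge:
  assumes "finite I"
  shows "wedge (wedge f c) d I =
    (\<Sum>(i, k) | i \<in> I \<and> k \<in> I \<and> i < k. scale (passing_factor i I * passing_factor k I)
      (f (I - {i, k}) * (c k * d i - scale q (c i * d k))))"
proof -
  let ?T = "\<lambda>k i. scale (passing_factor k I * passing_factor i (I - {k}))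
    (f (I - {k, i}) * (c i * d k))"
  let ?P = "{(i, k). i \<in> I \<and> k \<in> I \<and> i < k}"
  let ?Q = "{(i, k). i \<in> I \<and> k \<in> I \<and> k < i}"
  have fin: "finite ?P" "finite ?Q"
    by (rule finite_subset[of _ "I \<times> I"]; use assms in auto)+
  have split: "(SIGMA k:I. I - {k}) = ?P \<union> ?Q"
    by auto
  have remove_two: "I - {k, i} = I - {k} - {i}" for i k
    by auto
  have "wedge (wedge f c) d I = (\<Sum>k\<in>I. \<Sum>i\<in>I - {k}. ?T k i)"
    by (simp add: wedge_def sum_distrib_right scale_sum_right mult_scale_left mult.assoc
        remove_two)
  also have "\<dots> = (\<Sum>(k, i)\<in>?P \<union> ?Q. ?T k i)"
    by (subst sum.Sigma) (use assms split in auto)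
  also have "\<dots> = (\<Sum>(k, i)\<in>?P. ?T k i) + (\<Sum>(k, i)\<in>?Q. ?T k i)"
    by (rule sum.union_disjoint) (use fin in auto)
  also have "(\<Sum>(k, i)\<in>?Q. ?T k i) = (\<Sum>(i, k)\<in>?P. ?T k i)"
    by (rule sum.reindex_bij_witness[of _ prod.swap prod.swap]) auto
  also have "(\<Sum>(i, k)\<in>?P. ?T i k) + (\<Sum>(i, k)\<in>?P. ?T k i) =
    (\<Sum>(i, k)\<in>?P. scale (passing_factor i I * passing_factor k I)
      (f (I - {i, k}) * (c k * d i - scale q (c i * d k))))"
    unfolding sum.distrib[symmetric]
  proof (rule sum.cong[OF refl], clarify)
    fix i k
    assume ik: "i \<in> I" "k \<in> I" "i < k"
    show "?T i k + ?T k i = scale (passing_factor i I * passing_factor k I)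
      (f (I - {i, k}) * (c k * d i - scale q (c i * d k)))"
      using ik assms
      by (simp add: passing_factor_remove_above passing_factor_remove_below insert_commute
          right_diff_distrib scale_right_diff_distrib mult_scale_right mult.commute
          mult.left_commute)
  qed
  finally show ?thesis .
qed

lemma foldl_wedge_snoc:
  "foldl wedge f (cs @ [c]) I =
    (\<Sum>i\<in>I. scale (passing_factor i I) (foldl wedge f cs (I - {i}) * c i))"
  unfolding foldl_append foldl.simps by (rule wedge_def)

lemma wedge_infinite: "infinite I \<Longrightarrow> wedge f c I = 0"
  by (simp add: wedge_def)

lemma wedge_zero: "wedge (\<lambda>_. 0) c = (\<lambda>_. 0)"
  by (simp add: wedge_def fun_eq_iff)

lemma wedge_add: "wedge f (\<lambda>i. c i + d i) I = wedge f c I + wedge f d I"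
  by (simp add: wedge_def distrib_left scale_right_distrib sum.distrib)

lemma wedge_sum_right:
  "wedge f (\<lambda>i. \<Sum>a\<in>A. c a i * x a) I = (\<Sum>a\<in>A. wedge f (c a) I * x a)"
  by (simp add: wedge_def sum_distrib_left sum_distrib_right scale_sum_right mult_scale_left
      mult.assoc sum.swap[of _ A])

text \<open>
  The hypotheses of the next two lemmas are the two families of Manin relations, for one column and
  for two. They make the columns obey the relations of the generators themselves.
\<close>

lemma wedge_self:
  assumes "\<And>i k. i < k \<Longrightarrow> c i * c k = scale (inverse q) (c k * c i)"
  shows "wedge (wedge f c) c = (\<lambda>_. 0)"
proof
  fix I
  have "c k * c i - scale q (c i * c k) = 0" if "i < k" for i k
    using assms[OF that] q_nonzero by simp
  then show "wedge (wedge f c) c I = 0"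
    by (cases "finite I") (auto simp: wedge_wedge wedge_infinite intro!: sum.neutral)
qed

lemma wedge_swap:
  assumes "\<And>i k. i < k \<Longrightarrow> c i * d k - d k * c i =
    scale (inverse q) (c k * d i) - scale q (d i * c k)"
  shows "wedge (wedge f d) c I = scale (- inverse q) (wedge (wedge f c) d I)"
proof (cases "finite I")
  case True
  have "d k * c i - scale q (d i * c k) =
      scale (- inverse q) (c k * d i - scale q (c i * d k))" if "i < k" for i k
  proof -
    have "d k * c i = c i * d k - scale (inverse q) (c k * d i) + scale q (d i * c k)"
      using assms[OF that] by (simp add: algebra_simps)
    then show ?thesis
      using q_nonzero by (simp add: scale_right_diff_distrib)
  qed
  then show ?thesis
    unfolding wedge_wedge[OF True] scale_sum_right
    by (intro sum.cong refl) (clarsimp simp: mult_scale_right mult_ac simp del: scale_minus_left)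
next
  case False
  then show ?thesis
    by (simp add: wedge_infinite)
qed

lemma foldl_wedge_vacuum_two:
  assumes "i < k"
  shows "foldl wedge vacuum [c, d] {i, k} = c i * d k - scale (inverse q) (c k * d i)"
proof -
  have "{(x, y). x \<in> {i, k} \<and> y \<in> {i, k} \<and> x < y} = {(i, k)}"
    using assms by auto
  moreover have "{l \<in> {i, k}. i < l} = {k}" "{l \<in> {i, k}. k < l} = {}"
    using assms by auto
  then have "passing_factor i {i, k} = - inverse q" "passing_factor k {i, k} = 1"
    by (simp_all only: passing_factor_def card.empty power_0, simp)
  ultimately show ?thesis
    using q_nonzero by (simp add: wedge_wedge vacuum_def scale_right_diff_distrib)
qed

text \<open>
  Passing factors depend only on the order of the indices. This moves minors from submatrices, with
  rows renumbered from zero, to the rows of the ambient matrix.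
\<close>

lemma foldl_wedge_reindex:
  assumes "\<And>x y. x < y \<Longrightarrow> h x < h y"
    and "\<And>j i. j \<in> set js \<Longrightarrow> i \<in> I \<Longrightarrow> c j i = d j (h i)"
  shows "foldl wedge vacuum (map c js) I = foldl wedge vacuum (map d js) (h ` I)"
  using assms(2)
proof (induction js arbitrary: I rule: rev_induct)
  case Nil
  then show ?case
    by (simp add: vacuum_def)
next
  case (snoc j js)
  have h: "strict_mono h"
    using assms(1) by (rule strict_monoI)
  have inj: "inj h"
    using h by (rule strict_mono_imp_inj_on)
  have pf: "passing_factor (h i) (h ` I) = passing_factor i I" for i
  proof -
    have "{k \<in> h ` I. h i < k} = h ` {k \<in> I. i < k}"
      using h by (auto simp: strict_mono_less)
    then show ?thesis
      using inj by (simp add: passing_factor_def card_image inj_on_subset[OF inj])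
  qed
  have "foldl wedge vacuum (map c js) (I - {i}) =
      foldl wedge vacuum (map d js) (h ` I - {h i})" if "i \<in> I" for i
    using snoc.IH[of "I - {i}"] snoc.prems inj by (simp add: image_set_diff)
  then show ?case
    using snoc.prems inj
    unfolding list.map map_append foldl_wedge_snoc
    by (simp add: sum.reindex inj_on_subset[OF inj] pf cong: sum.cong)
qed

lemma foldl_wedge_degree:
  "finite I \<Longrightarrow> card I \<noteq> length cs \<Longrightarrow> foldl wedge vacuum cs I = 0"
proof (induction cs arbitrary: I rule: rev_induct)
  case Nil
  then show ?case
    by (auto simp: vacuum_def)
next
  case (snoc c cs)
  have "foldl wedge vacuum cs (I - {i}) = 0" if "i \<in> I" for i
  proof (rule snoc.IH)
    have "card I = Suc (card (I - {i}))"
      using snoc.prems(1) that by (rule card.remove)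
    with snoc.prems(2) show "card (I - {i}) \<noteq> length cs"
      by auto
  qed (use snoc.prems in simp)
  then show ?case
    unfolding foldl_wedge_snoc by simp
qed

text \<open>
  Vectors without components below \<open>n\<close> can only contribute generators from \<open>n\<close> on, so at
  \<open>{0..<n} \<union> I\<close> the whole part \<open>{0..<n}\<close> must come from \<open>f\<close>. The generators in \<open>I\<close> never have
  to pass one below \<open>n\<close>, hence no scalar appears. The condition on \<open>f\<close> excludes that
  generators of \<open>I\<close> already come from \<open>f\<close>.
\<close>

lemma foldl_wedge_factor:
  assumes f: "\<And>J. J \<subseteq> {n..} \<Longrightarrow> finite J \<Longrightarrow> J \<noteq> {} \<Longrightarrow> f ({0..<n} \<union> J) = 0"
    and c: "\<And>c i. c \<in> set cs \<Longrightarrow> i < n \<Longrightarrow> c i = 0"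
    and I: "I \<subseteq> {n..}" "finite I"
  shows "foldl wedge f cs ({0..<n} \<union> I) = f {0..<n} * foldl wedge vacuum cs I"
  using c I
proof (induction cs arbitrary: I rule: rev_induct)
  case Nil
  then show ?case
    using f by (simp add: vacuum_def)
next
  case (snoc c cs)
  let ?g = "foldl wedge f cs"
  have pf: "passing_factor i ({0..<n} \<union> I) = passing_factor i I" if "i \<in> I" for i
  proof -
    have "{k \<in> {0..<n} \<union> I. i < k} = {k \<in> I. i < k}"
      using that snoc.prems(2) by auto
    then show ?thesis
      by (simp add: passing_factor_def)
  qed
  have g: "?g ({0..<n} \<union> I - {i}) = f {0..<n} * foldl wedge vacuum cs (I - {i})" if "i \<in> I" for i
  proof -
    have "{0..<n} \<union> I - {i} = {0..<n} \<union> (I - {i})"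
      using that snoc.prems(2) by auto
    then show ?thesis
      using snoc.IH[of "I - {i}"] snoc.prems by auto
  qed
  have "foldl wedge f (cs @ [c]) ({0..<n} \<union> I) =
      (\<Sum>i\<in>I. scale (passing_factor i ({0..<n} \<union> I)) (?g ({0..<n} \<union> I - {i}) * c i))"
    unfolding foldl_wedge_snoc
  proof (rule sum.mono_neutral_right)
    have "c i = 0" if "i \<in> {0..<n} \<union> I - I" for i
      using snoc.prems(1)[of c i] that by auto
    then show "\<forall>i\<in>{0..<n} \<union> I - I. scale (passing_factor i ({0..<n} \<union> I))
        (?g ({0..<n} \<union> I - {i}) * c i) = 0"
      by (metis mult_zero_right scale_zero_right)
  qed (use snoc.prems in auto)
  also have "\<dots> = f {0..<n} * foldl wedge vacuum (cs @ [c]) I"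
    unfolding foldl_wedge_snoc
    by (simp add: pf g sum_distrib_left mult_scale_right mult.assoc cong: sum.cong)
  finally show ?case .
qed

section \<open>Quantum minors as coefficients\<close>

text \<open>
  Lists of distinct indices replace permutations here because removing the last entry corresponds
  to removing the last vector of the product, which permutations of a fixed set do not allow.
\<close>

lemma foldl_wedge_permutations:
  "foldl wedge vacuum cs I =
    (\<Sum>xs | distinct xs \<and> set xs = I \<and> length xs = length cs.
      scale ((- inverse q) ^ inv_count (length cs) ((!) xs))
        (prod_list (map (\<lambda>j. (cs ! j) (xs ! j)) [0..<length cs])))"
proof (induction cs arbitrary: I rule: rev_induct)
  case Nil
  have "{xs::nat list. distinct xs \<and> set xs = I \<and> length xs = length []} =
      (if I = {} then {[]} else {})"
    by auto
  then show ?case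
    by (simp add: vacuum_def inv_count_def)
next
  case (snoc c cs)
  let ?r = "length cs"
  let ?L = "\<lambda>I. {xs. distinct xs \<and> set xs = I \<and> length xs = ?r}"
  let ?t = "\<lambda>cs xs. scale ((- inverse q) ^ inv_count (length cs) ((!) xs))
        (prod_list (map (\<lambda>j. (cs ! j) (xs ! j)) [0..<length cs]))"
  show ?case
  proof (cases "finite I")
    case False
    then have "{xs. distinct xs \<and> set xs = I \<and> length xs = length (cs @ [c])} = {}"
      by auto
    with False show ?thesis
      unfolding foldl_wedge_snoc by (simp only: sum.infinite sum.empty not_False_eq_True)
  next
    case True
    have fin: "finite (?L J)" if "finite J" for J
      by (rule finite_subset[OF _ finite_lists_length_eq[OF that, of ?r]]) auto
    have step: "scale (passing_factor i I) (?t cs ys * c i) = ?t (cs @ [c]) (ys @ [i])"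
      if "i \<in> I" "ys \<in> ?L (I - {i})" for i ys
    proof -
      have "{k \<in> set ys. i < k} = {k \<in> I. i < k}"
        using that by auto
      then have "inv_count (Suc ?r) ((!) (ys @ [i])) =
          inv_count ?r ((!) ys) + card {k \<in> I. i < k}"
        using that inv_count_snoc[of ys i] by simp
      moreover have "prod_list (map (\<lambda>j. ((cs @ [c]) ! j) ((ys @ [i]) ! j)) [0..<?r]) =
          prod_list (map (\<lambda>j. (cs ! j) (ys ! j)) [0..<?r])"
        using that by (intro arg_cong[where f = prod_list]) (auto simp: nth_append)
      moreover have "(ys @ [i]) ! ?r = i"
        using that by (auto simp: nth_append)
      ultimately show ?thesis
        by (simp add: passing_factor_def power_add mult_scale_left mult.commute)
    qed
    have "foldl wedge vacuum (cs @ [c]) I =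
        (\<Sum>i\<in>I. \<Sum>ys\<in>?L (I - {i}). ?t (cs @ [c]) (ys @ [i]))"
      unfolding foldl_wedge_snoc snoc.IH sum_distrib_right scale_sum_right
      by (intro sum.cong refl) (rule step)
    also have "\<dots> = (\<Sum>(i, ys)\<in>(SIGMA i:I. ?L (I - {i})). ?t (cs @ [c]) (ys @ [i]))"
      by (rule sum.Sigma) (use True fin in auto)
    also have "\<dots> = (\<Sum>xs | distinct xs \<and> set xs = I \<and> length xs = length (cs @ [c]).
        ?t (cs @ [c]) xs)"
    proof (rule sum.reindex_bij_witness[of _ "\<lambda>xs. (last xs, butlast xs)" "\<lambda>(i, ys). ys @ [i]"],
        goal_cases)
      case (1 p)
      then show ?case
        by (simp add: case_prod_beta)
    next
      case (2 p)
      then obtain i ys where "p = (i, ys)" "i \<in> I" "ys \<in> ?L (I - {i})"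
        by blast
      then show ?case
        by (simp add: insert_absorb)
    next
      case (3 xs)
      then have "xs \<noteq> []"
        by auto
      then show ?case
        by simp
    next
      case (4 xs)
      then have "xs \<noteq> []"
        by auto
      then obtain ys x where "xs = ys @ [x]"
        by (cases xs rule: rev_cases) auto
      with 4 show ?case
        by auto
    next
      case (5 p)
      show ?case
        by (simp only: case_prod_beta)
    qed
    finally show ?thesis .
  qed
qed

lemma q_det_eq_foldl_wedge:
  assumes "N \<in> carrier_mat r r"
  shows "q_det scale q N = foldl wedge vacuum (map (column N) [0..<r]) {0..<r}"
proof -
  let ?L = "{xs. distinct xs \<and> set xs = {0..<r} \<and> length xs = length (map (column N) [0..<r])}"
  let ?p = "\<lambda>xs i. if i < r then xs ! i else (i::nat)"
  have perm: "?p xs permutes {0..<r}" if "xs \<in> ?L" for xs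
  proof (rule bij_imp_permutes)
    have "bij_betw ((!) xs) {0..<r} {0..<r}"
      using that bij_betw_nth[of xs "{0..<r}" "{0..<r}"] by (auto simp: atLeast0LessThan)
    then show "bij_betw (?p xs) {0..<r} {0..<r}"
      by (subst bij_betw_cong[where g = "(!) xs"]) auto
  qed simp
  have list: "map \<tau> [0..<r] \<in> ?L" if "\<tau> permutes {0..<r}" for \<tau>
    using that by (simp add: distinct_map permutes_inj_on permutes_image)
  have "inv_count r ((!) (map \<tau> [0..<r])) = inv_count r \<tau>" for \<tau>
    by (rule inv_count_cong) simp
  moreover have "(- q) powi (- int k) = (- inverse q) ^ k" for k
    by (simp add: power_int_minus flip: power_inverse inverse_minus_eq)
  moreover have "prod_list (map (\<lambda>j. (map (column N) [0..<r] ! j) (map \<tau> [0..<r] ! j)) [0..<r]) =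
      prod_list (map (\<lambda>j. N $$ (\<tau> j, j)) [0..<r])" if "\<tau> permutes {0..<r}" for \<tau>
    using that assms permutes_in_image[OF that]
    by (intro arg_cong[where f = prod_list]) (auto simp: column_def)
  ultimately have summand: "scale ((- inverse q) ^ inv_count (length (map (column N) [0..<r]))
          ((!) (map \<tau> [0..<r])))
        (prod_list (map (\<lambda>j. (map (column N) [0..<r] ! j) (map \<tau> [0..<r] ! j))
          [0..<length (map (column N) [0..<r])])) =
      scale ((- q) powi (- int (inv_count r \<tau>)))
        (prod_list (map (\<lambda>j. N $$ (\<tau> j, j)) [0..<r]))" if "\<tau> permutes {0..<r}" for \<tau>
    using that by simp
  have "dim_row N = r"
    using assms by simp
  show ?thesis
    unfolding q_det_def foldl_wedge_permutations \<open>dim_row N = r\<close>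
  proof (rule sum.reindex_bij_witness[of _ ?p "\<lambda>\<tau>. map \<tau> [0..<r]"], goal_cases)
    case (1 \<tau>)
    then show ?case
      by (auto simp: fun_eq_iff permutes_def)
  next
    case (2 \<tau>)
    then show ?case
      using list by simp
  next
    case (3 xs)
    then show ?case
      by (auto intro: nth_equalityI)
  next
    case (4 xs)
    then show ?case
      using perm by simp
  next
    case (5 \<tau>)
    then show ?case
      using summand by simp
  qed
qed

lemma column_self:
  assumes "q_manin scale q M" "j < dim_col M" "i < k"
  shows "column M j i * column M j k = scale (inverse q) (column M j k * column M j i)"
proof (cases "k < dim_row M")
  case True
  then have "M $$ (i, j) * M $$ (k, j) = scale (inverse q) (M $$ (k, j) * M $$ (i, j))"
    using assms unfolding q_manin_def by blast
  then show ?thesis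
    using True assms(3) by (simp add: column_def)
qed (simp add: column_def)

lemma column_swap:
  assumes "q_manin scale q M" "j < l" "l < dim_col M" "i < k"
  shows "column M j i * column M l k - column M l k * column M j i =
    scale (inverse q) (column M j k * column M l i) - scale q (column M l i * column M j k)"
proof (cases "k < dim_row M")
  case True
  then have "M $$ (i, j) * M $$ (k, l) - M $$ (k, l) * M $$ (i, j) =
      scale (inverse q) (M $$ (k, j) * M $$ (i, l)) - scale q (M $$ (i, l) * M $$ (k, j))"
    using assms unfolding q_manin_def by blast
  then show ?thesis
    using True assms(4) by (simp add: column_def)
qed (simp add: column_def)

section \<open>Reduction modulo the leading columns\<close>

text \<open>
  Up to a scalar, the column \<open>a\<close> can be moved to the left of the column \<open>l\<close>, where it meets
  \<open>f\<close> directly.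
\<close>

lemma wedge_column_annihilated:
  assumes "q_manin scale q M" "a \<le> l" "l < dim_col M"
    and "wedge f (column M a) = (\<lambda>_. 0)"
  shows "wedge (wedge f (column M l)) (column M a) = (\<lambda>_. 0)"
proof (cases "a = l")
  case True
  then show ?thesis
    using assms by (simp add: wedge_zero)
next
  case False
  then have "wedge (wedge f (column M l)) (column M a) I =
      scale (- inverse q) (wedge (wedge f (column M a)) (column M l) I)" for I
    using assms by (intro wedge_swap column_swap) auto
  then show ?thesis
    using assms by (simp add: wedge_zero fun_eq_iff)
qed

lemma leading_columns_annihilate:
  assumes "q_manin scale q M" "n \<le> dim_col M" "a < n"
  shows "wedge (foldl wedge f (map (column M) [0..<n])) (column M a) = (\<lambda>_. 0)"
  using assms(2,3)
proof (induction n)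
  case (Suc n)
  show ?case
  proof (cases "a = n")
    case True
    then show ?thesis
      using Suc.prems assms(1) wedge_self[OF column_self] by simp
  next
    case False
    then show ?thesis
      using Suc assms(1) by (simp add: wedge_column_annihilated)
  qed
qed simp

text \<open>
  On the first \<open>n\<close> rows, every column of \<open>M\<close> is a right linear combination of the first \<open>n\<close>
  columns: \<open>X\<close> is the inverse of the leading block times the first \<open>n\<close> rows of \<open>M\<close>.
\<close>

lemma leading_block_spans_columns:
  assumes "invertible_mat (leading_block n M)" "n \<le> dim_row M"
  obtains X where "\<And>i l. i < n \<Longrightarrow> column M l i = (\<Sum>a<n. column M a i * X a l)"
proof -
  let ?A = "leading_block n M"
  obtain C where C: "?A * C = 1\<^sub>m n" "C * ?A = 1\<^sub>m (dim_row C)"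
    using assms(1) by (auto simp: invertible_mat_def inverts_mat_def leading_block_def)
  have dims: "dim_col C = n" "dim_row C = n"
    using arg_cong[OF C(1), of dim_col] arg_cong[OF C(2), of dim_col]
    by (simp_all add: leading_block_def)
  define X where "X a l = (\<Sum>b<n. C $$ (a, b) * column M l b)" for a l
  have "column M l i = (\<Sum>a<n. column M a i * X a l)" if "i < n" for i l
  proof -
    have unit: "(\<Sum>a<n. column M a i * C $$ (a, b)) = (if i = b then 1 else 0)" if "b < n" for b
    proof -
      have "(?A * C) $$ (i, b) = (\<Sum>a<n. column M a i * C $$ (a, b))"
        using \<open>i < n\<close> that dims assms(2)
        by (simp add: leading_block_def scalar_prod_def column_def atLeast0LessThan)
      then show ?thesis
        using \<open>i < n\<close> that C(1) by simp
    qed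
    have "(\<Sum>a<n. column M a i * X a l) =
        (\<Sum>b<n. (\<Sum>a<n. column M a i * C $$ (a, b)) * column M l b)"
      unfolding X_def sum_distrib_left sum_distrib_right
      by (subst sum.swap) (simp add: mult.assoc)
    also have "\<dots> = (\<Sum>b<n. if i = b then column M l b else 0)"
      by (rule sum.cong) (auto simp: unit)
    finally show ?thesis
      using that by simp
  qed
  then show thesis
    by (rule that)
qed

text \<open>
  A column may be reduced by the leading ones because the product accumulated so far annihilates
  them. This annihilation is the second claim; it speaks of the original columns because the Manin
  relations that propagate it are relations between these.
\<close>

lemma wedge_reduced_columns:
  fixes X :: "nat \<Rightarrow> nat \<Rightarrow> 'a"
  assumes "q_manin scale q M" "set js \<subseteq> {n..<dim_col M}"
    and S: "\<And>l i. S l i = column M l i - (\<Sum>a<n. column M a i * X a l)"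
    and f: "\<And>a. a < n \<Longrightarrow> wedge f (column M a) = (\<lambda>_. 0)"
  shows "foldl wedge f (map S js) = foldl wedge f (map (column M) js)"
    and "\<And>a. a < n \<Longrightarrow> wedge (foldl wedge f (map (column M) js)) (column M a) = (\<lambda>_. 0)"
  using assms(2)
proof (induction js rule: rev_induct)
  case Nil
  {
    case 1
    then show ?case
      by simp
  next
    case 2
    then show ?case
      using f by simp
  }
next
  case (snoc l js)
  let ?g = "foldl wedge f (map (column M) js)"
  {
    case 1
    then have g: "foldl wedge f (map S js) = ?g"
      "\<And>a. a < n \<Longrightarrow> wedge ?g (column M a) = (\<lambda>_. 0)"
      using snoc.IH by simp_all
    have "wedge ?g (S l) I = wedge ?g (column M l) I" for I
    proof -
      have "column M l = (\<lambda>i. S l i + (\<Sum>a<n. column M a i * X a l))"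
        by (simp add: S fun_eq_iff)
      then have "wedge ?g (column M l) I =
          wedge ?g (S l) I + (\<Sum>a<n. wedge ?g (column M a) I * X a l)"
        using wedge_add[of ?g "S l" "\<lambda>i. \<Sum>a<n. column M a i * X a l" I]
          wedge_sum_right[of ?g "column M" "\<lambda>a. X a l" "{..<n}" I] by simp
      then show ?thesis
        using g(2) by simp
    qed
    then show ?case
      by (simp add: g(1) fun_eq_iff)
  next
    case 2
    then show ?case
      using snoc.IH(2) assms(1) by (simp add: wedge_column_annihilated)
  }
qed

lemma q_det_leading_block:
  assumes "n \<le> dim_row M"
  shows "q_det scale q (leading_block n M) =
    foldl wedge vacuum (map (column M) [0..<n]) {0..<n}"
proof -
  have "leading_block n M \<in> carrier_mat n n"
    by (simp add: leading_block_def)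
  then have "q_det scale q (leading_block n M) =
      foldl wedge vacuum (map (column (leading_block n M)) [0..<n]) {0..<n}"
    by (rule q_det_eq_foldl_wedge)
  also have "\<dots> = foldl wedge vacuum (map (column M) [0..<n]) ((\<lambda>i. i) ` {0..<n})"
    using assms by (intro foldl_wedge_reindex) (auto simp: column_def leading_block_def)
  finally show ?thesis
    by simp
qed

lemma q_det_bordered_mat:
  assumes "n \<le> i" "i < dim_row M"
  shows "q_det scale q (bordered_mat n M i j) =
    foldl wedge vacuum (map (column M) ([0..<n] @ [j])) ({0..<n} \<union> {i})"
proof -
  let ?N = "bordered_mat n M i j"
  \<comment> \<open>Index \<open>n\<close> of the bordered matrix stands for row \<open>i\<close> and column \<open>j\<close> of \<open>M\<close>.\<close>
  let ?h = "\<lambda>x. if x < n then x else x - n + i"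
  let ?d = "\<lambda>x. column M (if x < n then x else j)"
  have N: "?N \<in> carrier_mat (Suc n) (Suc n)"
    by (rule carrier_matI) (simp_all add: bordered_mat_def leading_block_def)
  have "q_det scale q ?N = foldl wedge vacuum (map (column ?N) [0..<Suc n]) {0..<Suc n}"
    using N by (rule q_det_eq_foldl_wedge)
  also have "\<dots> = foldl wedge vacuum (map ?d [0..<Suc n]) (?h ` {0..<Suc n})"
    using assms
    by (intro foldl_wedge_reindex)
       (auto simp: column_def bordered_mat_def leading_block_def less_Suc_eq)
  also have "map ?d [0..<Suc n] = map (column M) ([0..<n] @ [j])"
    by simp
  also have "?h ` {0..<Suc n} = {0..<n} \<union> {i}"
    by (auto simp: atLeast0_lessThan_Suc)
  finally show ?thesis .
qed

section \<open>Sylvester's identity\<close>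

text \<open>
  The product of the first \<open>n\<close> columns followed by further columns factors through the Schur
  complement \<open>S\<close>; the fact \<open>factor\<close> is used with one, two and all \<open>m - n\<close> further columns.
\<close>

lemma sylvester_identity:
  assumes M: "M \<in> carrier_mat m m" and manin: "q_manin scale q M" and nm: "n < m"
    and inv: "invertible_mat (leading_block n M)"
    and a_inv: "two_sided_invertible (q_det scale q (leading_block n M))"
  shows "q_manin scale q (sylvester_mat scale q n M)"
    and "q_det scale q (sylvester_mat scale q n M) =
      ring_inv (q_det scale q (leading_block n M)) * q_det scale q M"
proof -
  let ?a = "q_det scale q (leading_block n M)"
  let ?B = "sylvester_mat scale q n M"
  let ?\<Omega> = "foldl wedge vacuum (map (column M) [0..<n])"
  have dims: "dim_row M = m" "dim_col M = m"
    using M by auto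
  have B: "?B \<in> carrier_mat (m - n) (m - n)"
    using dims by (simp add: sylvester_mat_def)
  have cancel: "ring_inv ?a * (?a * x) = x" for x
    using ring_inv_left[OF a_inv] by (metis mult.assoc mult_1_left)
  obtain X where X: "\<And>i l. i < n \<Longrightarrow> column M l i = (\<Sum>a<n. column M a i * X a l)"
    using leading_block_spans_columns[OF inv, of thesis] nm dims by auto
  \<comment> \<open>The columns of the Schur complement of the leading block, extended by zero to all rows.\<close>
  define S where "S l i = column M l i - (\<Sum>a<n. column M a i * X a l)" for l i
  have factor: "foldl wedge vacuum (map (column M) ([0..<n] @ js)) ({0..<n} \<union> I) =
      ?a * foldl wedge vacuum (map S js) I"
    if "set js \<subseteq> {n..<m}" "I \<subseteq> {n..}" "finite I" for js I
  proof -
    have "foldl wedge ?\<Omega> (map S js) = foldl wedge ?\<Omega> (map (column M) js)"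
    proof (rule wedge_reduced_columns(1))
      show "wedge ?\<Omega> (column M a) = (\<lambda>_. 0)" if "a < n" for a
        using leading_columns_annihilate[OF manin _ that] nm dims by simp
    qed (use manin that dims S_def in auto)
    then have "foldl wedge vacuum (map (column M) ([0..<n] @ js)) ({0..<n} \<union> I) =
        foldl wedge ?\<Omega> (map S js) ({0..<n} \<union> I)"
      by simp
    also have "\<dots> = ?\<Omega> {0..<n} * foldl wedge vacuum (map S js) I"
    proof (rule foldl_wedge_factor)
      fix J :: "nat set"
      assume J: "J \<subseteq> {n..}" "finite J" "J \<noteq> {}"
      then have "card ({0..<n} \<union> J) = n + card J"
        by (subst card_Un_disjoint) auto
      with J show "?\<Omega> ({0..<n} \<union> J) = 0"
        by (intro foldl_wedge_degree) (auto simp: card_gt_0_iff)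
    next
      show "c i = 0" if "c \<in> set (map S js)" "i < n" for c i
        using that by (auto simp: S_def X[symmetric])
    qed (use that in auto)
    finally show ?thesis
      using nm dims by (simp add: q_det_leading_block)
  qed
  \<comment> \<open>The matrix \<open>B\<close> is the Schur complement.\<close>
  have entry: "?B $$ (i, j) = S (n + j) (n + i)" if "i < m - n" "j < m - n" for i j
  proof -
    have "q_det scale q (bordered_mat n M (n + i) (n + j)) =
        foldl wedge vacuum (map (column M) ([0..<n] @ [n + j])) ({0..<n} \<union> {n + i})"
      using that dims by (intro q_det_bordered_mat) auto
    also have "\<dots> = ?a * foldl wedge vacuum (map S [n + j]) {n + i}"
      using that by (intro factor) auto
    also have "foldl wedge vacuum (map S [n + j]) {n + i} = S (n + j) (n + i)"
    proof -
      have "{k \<in> {n + i}. n + i < k} = {}"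
        by auto
      then have "passing_factor (n + i) {n + i} = 1"
        by (simp only: passing_factor_def card.empty power_0)
      then show ?thesis
        by (simp add: wedge_def vacuum_def)
    qed
    finally show ?thesis
      using that dims cancel by (simp add: sylvester_mat_def)
  qed
  \<comment> \<open>The columns \<open>j\<close> and \<open>l\<close> may come in either order and may coincide, so the relations between
    columns of \<open>M\<close> carry over to all the two-by-two minors of \<open>S\<close>.\<close>
  have minor: "S j i * S l k - scale (inverse q) (S j k * S l i) =
      ring_inv ?a * wedge (wedge ?\<Omega> (column M j)) (column M l) ({0..<n} \<union> {i, k})"
    if "n \<le> i" "i < k" "j \<in> {n..<m}" "l \<in> {n..<m}" for i k j l
  proof -
    have "wedge (wedge ?\<Omega> (column M j)) (column M l) ({0..<n} \<union> {i, k}) =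
        ?a * foldl wedge vacuum (map S [j, l]) {i, k}"
      using that by (subst factor[symmetric]) auto
    then show ?thesis
      using cancel foldl_wedge_vacuum_two[OF that(2)] by simp
  qed
  have same: "S j i * S j k = scale (inverse q) (S j k * S j i)"
    if "n \<le> i" "i < k" "j \<in> {n..<m}" for i k j
  proof -
    have "wedge (wedge ?\<Omega> (column M j)) (column M j) = (\<lambda>_. 0)"
      using that manin dims by (intro wedge_self column_self) auto
    then show ?thesis
      using minor[OF that(1,2,3,3)] by simp
  qed
  have cross: "S j i * S l k - S l k * S j i =
      scale (inverse q) (S j k * S l i) - scale q (S l i * S j k)"
    if "n \<le> i" "i < k" "j \<in> {n..<m}" "l \<in> {n..<m}" "j < l" for i k j l
  proof -
    have "wedge (wedge ?\<Omega> (column M l)) (column M j) I =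
        scale (- inverse q) (wedge (wedge ?\<Omega> (column M j)) (column M l) I)" for I
      using that manin dims by (intro wedge_swap column_swap) auto
    then have "S l i * S j k - scale (inverse q) (S l k * S j i) =
        scale (- inverse q) (S j i * S l k - scale (inverse q) (S j k * S l i))"
      unfolding minor[OF that(1,2,3,4)] minor[OF that(1,2,4,3)] by (simp only: mult_scale_right)
    \<comment> \<open>Multiplied by \<open>- q\<close>, this is the cross relation up to reordering the terms.\<close>
    then have "scale (- q) (S l i * S j k - scale (inverse q) (S l k * S j i)) =
        scale (- q) (scale (- inverse q) (S j i * S l k - scale (inverse q) (S j k * S l i)))"
      by (rule arg_cong)
    then show ?thesis
      using q_nonzero by (simp add: scale_right_diff_distrib algebra_simps)
  qed
  show "q_manin scale q ?B"
    unfolding q_manin_def using B same cross by (auto simp: entry)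
  have "{0..<n} \<union> {n..<m} = {0..<m}" "[0..<n] @ [n..<m] = [0..<m]"
    using nm upt_add_eq_append[of 0 n "m - n"] by auto
  then have M_det: "q_det scale q M = ?a * foldl wedge vacuum (map S [n..<m]) {n..<m}"
    using factor[of "[n..<m]" "{n..<m}"] q_det_eq_foldl_wedge[OF M] by force
  have "q_det scale q ?B = foldl wedge vacuum (map (column ?B) [0..<m - n]) {0..<m - n}"
    using B by (rule q_det_eq_foldl_wedge)
  also have "\<dots> = foldl wedge vacuum (map (\<lambda>j. S (n + j)) [0..<m - n]) ((+) n ` {0..<m - n})"
    using B by (intro foldl_wedge_reindex) (auto simp: column_def entry)
  also have "map (\<lambda>j. S (n + j)) [0..<m - n] = map S [n..<m]"
    using nm by (auto intro: nth_equalityI)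
  also have "(+) n ` {0..<m - n} = {n..<m}"
    using nm by simp
  finally show "q_det scale q ?B = ring_inv ?a * q_det scale q M"
    unfolding M_det cancel .
qed

end

theorem theorem4p10:
  fixes scale :: "complex \<Rightarrow> 'a::ring_1 \<Rightarrow> 'a"
    and q :: complex
    and M :: "'a mat"
    and m n :: nat
  assumes "complex_algebra scale"
    and "q \<noteq> 0"
    and "M \<in> carrier_mat m m"
    and "q_manin scale q M"
    and "1 \<le> n" and "n < m"
    and "invertible_mat M"
    and "two_sided_invertible (q_det scale q M)"
    and "invertible_mat (leading_block n M)"
    and "two_sided_invertible (q_det scale q (leading_block n M))"
    and "\<And>i j. n \<le> i \<Longrightarrow> i < m \<Longrightarrow> n \<le> j \<Longrightarrow> j < m \<Longrightarrow> invertible_mat (bordered_mat n M i j)"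
    and "\<And>i j. n \<le> i \<Longrightarrow> i < m \<Longrightarrow> n \<le> j \<Longrightarrow> j < m \<Longrightarrow>
      two_sided_invertible (q_det scale q (bordered_mat n M i j))"
    and "invertible_mat (sylvester_mat scale q n M)"
    and "two_sided_invertible (q_det scale q (sylvester_mat scale q n M))"
  shows "q_manin scale q (sylvester_mat scale q n M) \<and>
    q_det scale q (sylvester_mat scale q n M) =
      ring_inv (q_det scale q (leading_block n M)) * q_det scale q M"
proof -
  interpret q_exterior scale q
    using assms(1,2) by (simp add: q_exterior_def q_exterior_axioms_def)
  show ?thesis
    using sylvester_identity[OF assms(3,4,6,9,10)] by blast
qed

end
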